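(* Let $G$ be a finite group of order $n$ with a fixed listing $g_1,\dots,g_n$ of its elements, let $\{e_1,\dots,e_k\}$ be the complete orthogonal set of primitive central idempotents of $\mathbb{C}G$, and let $r_i=\operatorname{rank}\sigma(e_i)$. Let $P\in\mathbb{C}^{n\times n}$ be a non-singular matrix such that for every $\mathbb{C}G$-matrix $A$ the matrix $P^{-1}AP$ is block diagonal of the form $\operatorname{diag}(T_1,\dots,T_k)$ with $T_i$ of size $r_i\times r_i$ (such a $P$ exists). Then the group ring $\mathbb{C}G$ is isomorphic to a subring of the ring of block diagonal matrices $\operatorname{diag}(T_1,\dots,T_k)$ with $T_i\in\mathbb{C}^{r_i\times r_i}$, and the isomorphism onto this subring is given by $w\mapsto P^{-1}\sigma(w)P$.
   Context: For a finite group $G$ with a fixed listing $g_1,\dots,g_n$ of its elements and $w=\sum_{g\in G}\alpha_g g\in\mathbb{C}G$, let $\sigma(w)$ be the $n\times n$ complex matrix whose $(i,j)$ entry is $\alpha_{g_i^{-1}g_j}$. A $\mathbb{C}G$-matrix (group ring matrix), relative to the listing, is a matrix of the form $\sigma(w)$ with $w\in\mathbb{C}G$. A complete orthogonal set of idempotents in a ring with identity $1$ is a set $\{e_1,\dots,e_k\}$ with $e_i^2=e_i$, $e_ie_j=0$ for $i\ne j$, and $e_1+\dots+e_k=1$. *)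

theory Defs
  imports "HOL-Algebra.Subrings" "Jordan_Normal_Form.DL_Rank"
begin

text \<open>
  The group ring \<open>\<complex>G\<close> of a finite group: \<open>\<Sum>\<alpha>\<^sub>g g\<close> is the function \<open>g \<mapsto> \<alpha>\<^sub>g\<close>, set to \<open>0\<close>
  outside the carrier of \<open>G\<close> so that equality of functions is equality in \<open>\<complex>G\<close>.
\<close>

definition cgroup_ring :: "('g, 'm) monoid_scheme \<Rightarrow> ('g \<Rightarrow> complex) ring" where
  "cgroup_ring G = \<lparr>
     carrier = {w. \<forall>g. g \<notin> carrier G \<longrightarrow> w g = 0},
     mult = (\<lambda>v w g. \<Sum>(x, y) \<in> {(x, y) \<in> carrier G \<times> carrier G. x \<otimes>\<^bsub>G\<^esub> y = g}. v x * w y),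
     one = (\<lambda>g. if g = \<one>\<^bsub>G\<^esub> then 1 else 0),
     zero = (\<lambda>g. 0),
     add = (\<lambda>v w g. v g + w g)\<rparr>"

definition group_ring_mat ::
    "('g, 'm) monoid_scheme \<Rightarrow> 'g list \<Rightarrow> ('g \<Rightarrow> complex) \<Rightarrow> complex mat" where
  "group_ring_mat G gs w =
     mat (length gs) (length gs) (\<lambda>(i, j). w (inv\<^bsub>G\<^esub> (gs ! i) \<otimes>\<^bsub>G\<^esub> gs ! j))"

definition central_idempotent :: "('a, 'm) ring_scheme \<Rightarrow> 'a \<Rightarrow> bool" where
  "central_idempotent R e \<longleftrightarrow>
     e \<in> carrier R \<and> e \<otimes>\<^bsub>R\<^esub> e = e \<and> (\<forall>x \<in> carrier R. e \<otimes>\<^bsub>R\<^esub> x = x \<otimes>\<^bsub>R\<^esub> e)"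

text \<open>
  Primitivity is meant among central idempotents: \<open>e\<close> need not be primitive as an idempotent of \<open>R\<close>.
\<close>

definition primitive_central_idempotent :: "('a, 'm) ring_scheme \<Rightarrow> 'a \<Rightarrow> bool" where
  "primitive_central_idempotent R e \<longleftrightarrow>
     central_idempotent R e \<and> e \<noteq> \<zero>\<^bsub>R\<^esub> \<and>
     \<not> (\<exists>a b. central_idempotent R a \<and> central_idempotent R b \<and>
           a \<noteq> \<zero>\<^bsub>R\<^esub> \<and> b \<noteq> \<zero>\<^bsub>R\<^esub> \<and> a \<otimes>\<^bsub>R\<^esub> b = \<zero>\<^bsub>R\<^esub> \<and> e = a \<oplus>\<^bsub>R\<^esub> b)"

definition complete_orthogonal_idempotents :: "('a, 'm) ring_scheme \<Rightarrow> 'a set \<Rightarrow> bool" where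
  "complete_orthogonal_idempotents R E \<longleftrightarrow>
     finite E \<and> E \<subseteq> carrier R \<and>
     (\<forall>e \<in> E. e \<otimes>\<^bsub>R\<^esub> e = e) \<and>
     (\<forall>e \<in> E. \<forall>f \<in> E. e \<noteq> f \<longrightarrow> e \<otimes>\<^bsub>R\<^esub> f = \<zero>\<^bsub>R\<^esub>) \<and>
     (\<Oplus>\<^bsub>R\<^esub> e \<in> E. e) = \<one>\<^bsub>R\<^esub>"

definition block_diag_ring :: "nat list \<Rightarrow> complex mat ring" where
  "block_diag_ring rs =
     (ring_mat TYPE(complex) (sum_list rs) ())
       \<lparr>carrier := {diag_block_mat Ts |Ts. list_all2 (\<lambda>T r. T \<in> carrier_mat r r) Ts rs}\<rparr>"

definition conj_mat :: "nat \<Rightarrow> complex mat \<Rightarrow> complex mat \<Rightarrow> complex mat" where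
  "conj_mat n P A = inv\<^bsub>ring_mat TYPE(complex) n ()\<^esub> P * A * P"

definition block_diagonalizes ::
    "('g, 'm) monoid_scheme \<Rightarrow> 'g list \<Rightarrow> nat list \<Rightarrow> complex mat \<Rightarrow> bool" where
  "block_diagonalizes G gs rs P \<longleftrightarrow>
     P \<in> carrier_mat (length gs) (length gs) \<and> invertible_mat P \<and>
     (\<forall>A \<in> group_ring_mat G gs ` carrier (cgroup_ring G).
        conj_mat (length gs) P A \<in> carrier (block_diag_ring rs))"

end

(*
  The images of the matrices sigma(e_i) decompose C^n into subspaces invariant under every
  CG-matrix, because the e_i are central. Factor each sigma(e_i) = B_i C_i through its rank, so that
  C_i B_i = 1; then P = [B_1 ... B_k] has as inverse the stack of the C_i, and the off-diagonal
  block C_i A B_j = C_i sigma(e_i) A sigma(e_j) B_j vanishes for every CG-matrix A. That sigma and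
  hence its conjugates are ring embeddings is a computation with the group multiplication.
*)
theory Submission
  imports Defs
begin

section \<open>Rank factorization and idempotent matrices\<close>

text \<open>The columns of \<open>B\<close> form a maximal linearly independent set of columns of
  \<open>A\<close>, and column j of \<open>C\<close> holds the coordinates of column j of
  \<open>A\<close> with respect to them. The last two conclusions record how \<open>B\<close> was
  chosen; in the idempotent case they yield \<open>C * B = 1\<close>.\<close>

lemma (in vec_space) rank_factorization:
  assumes A: "A \<in> carrier_mat n nc"
  obtains B C where "B \<in> carrier_mat n (rank A)" "C \<in> carrier_mat (rank A) nc" "A = B * C"
    "set (cols B) \<subseteq> set (cols A)"
    "\<And>v. v \<in> carrier_vec (rank A) \<Longrightarrow> B *\<^sub>v v = 0\<^sub>v n \<Longrightarrow> v = 0\<^sub>v (rank A)"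
proof -
  let ?P = "\<lambda>T. T \<subseteq> set (cols A) \<and> lin_indpt T"
  have colsA: "set (cols A) \<subseteq> carrier_vec n"
    using A cols_dim[of A] by simp
  have "lin_indpt {}"
    by (rule finite_lin_indpt2) auto
  then obtain S where S: "finite S" "maximal S ?P"
    using maximal_exists_superset[of "set (cols A)" ?P "{}"] by auto
  then have SA: "S \<subseteq> set (cols A)" and li: "lin_indpt S"
    unfolding maximal_def by auto
  have rk: "rank A = card S"
    using rank_card_indpt[OF A S(2)] .
  obtain xs where xs: "set xs = S" "distinct xs"
    using finite_distinct_list[OF S(1)] by auto
  have len: "length xs = rank A"
    using rk xs distinct_card by fastforce
  define B where "B = mat_of_cols n xs"
  have B: "B \<in> carrier_mat n (rank A)"
    unfolding B_def using len by auto
  have Sn: "S \<subseteq> carrier_vec n"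
    using SA colsA by blast
  have colsB: "cols B = xs"
    unfolding B_def using xs Sn by simp
  \<comment> \<open>A column outside the span of \<open>S\<close> could be added to \<open>S\<close>
    without losing independence, against maximality.\<close>
  have in_span: "v \<in> span S" if "v \<in> set (cols A)" for v
  proof (rule ccontr)
    assume v: "v \<notin> span S"
    have vn: "v \<in> carrier_vec n" using that colsA by blast
    have "v \<notin> S" using v Sn span_mem by auto
    moreover have "lin_indpt (S \<union> {v})"
      using lin_dep_iff_in_span[OF Sn li vn \<open>v \<notin> S\<close>] v by auto
    moreover have "S \<union> {v} \<subseteq> set (cols A)"
      using SA that by simp
    ultimately have "S \<union> {v} = S"
      using S(2) unfolding maximal_def by (elim conjE allE[of _ "S \<union> {v}"]) auto
    then show False
      using \<open>v \<notin> S\<close> by auto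
  qed
  \<comment> \<open>The coordinate vector is read off from a linear combination: entry i is the
    coefficient of column i of \<open>B\<close>.\<close>
  have "\<exists>c. c \<in> carrier_vec (rank A) \<and> B *\<^sub>v c = col A j" if "j < nc" for j
  proof -
    have "col A j \<in> span S"
      using in_span A that by (metis carrier_matD(2) cols_length cols_nth nth_mem)
    then obtain a where "col A j = lincomb a S"
      using finite_in_span[OF S(1) Sn] by metis
    then have "B *\<^sub>v vec (rank A) (\<lambda>i. a (col B i)) = col A j"
      using mat_mult_eq_lincomb[OF B] colsB xs by simp
    then show ?thesis by (meson vec_carrier)
  qed
  then obtain c where c: "\<And>j. j < nc \<Longrightarrow> c j \<in> carrier_vec (rank A) \<and> B *\<^sub>v c j = col A j"
    by metis
  define C where "C = mat_of_cols (rank A) (map c [0..<nc])"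
  have C: "C \<in> carrier_mat (rank A) nc"
    unfolding C_def using mat_of_cols_carrier(1)[of "rank A" "map c [0..<nc]"] by simp
  have "A = B * C"
  proof (rule mat_col_eqI)
    fix j assume "j < dim_col (B * C)"
    then have j: "j < nc" using C by simp
    then have "col C j = c j"
      unfolding C_def using c by (subst col_mat_of_cols) auto
    then show "col A j = col (B * C) j"
      using c[OF j] col_mult2[OF B C j] by simp
  qed (use A B C in auto)
  \<comment> \<open>A nonzero kernel vector would be a linear dependence between the distinct
    columns of \<open>B\<close>.\<close>
  have inj: "v = 0\<^sub>v (rank A)" if "v \<in> carrier_vec (rank A)" "B *\<^sub>v v = 0\<^sub>v n" for v
    using lin_depI[OF B that(1) _ that(2)] li colsB xs by auto
  show ?thesis
    by (rule that[OF B C \<open>A = B * C\<close> _ inj]) (use colsB xs SA in auto)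
qed

text \<open>An idempotent fixes its own columns, and the columns of \<open>B\<close> are among them.
  Hence \<open>B * (C * B) = E * B = B\<close>, and injectivity of \<open>B\<close> allows
  cancelling it on the left.\<close>

lemma (in vec_space) idempotent_rank_splitting:
  assumes E: "E \<in> carrier_mat n n" and idem: "E * E = E"
  obtains B C where "B \<in> carrier_mat n (rank E)" "C \<in> carrier_mat (rank E) n"
    "B * C = E" "C * B = 1\<^sub>m (rank E)"
proof -
  obtain B C where B: "B \<in> carrier_mat n (rank E)" and C: "C \<in> carrier_mat (rank E) n"
    and BC: "E = B * C" and sub: "set (cols B) \<subseteq> set (cols E)"
    and inj: "\<And>v. v \<in> carrier_vec (rank E) \<Longrightarrow> B *\<^sub>v v = 0\<^sub>v n \<Longrightarrow> v = 0\<^sub>v (rank E)"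
    using rank_factorization[OF E] by metis
  have "E * B = B"
  proof (rule mat_col_eqI)
    fix j assume "j < dim_col B"
    then have j: "j < rank E" using B by simp
    then have "col B j \<in> set (cols E)"
      using sub B by (metis carrier_matD(2) cols_length cols_nth nth_mem subsetD)
    then obtain k where k: "k < n" "col B j = col E k"
      using E by (metis carrier_matD(2) cols_length cols_nth in_set_conv_nth)
    have "col (E * B) j = E *\<^sub>v col E k"
      using col_mult2[OF E B j] k by simp
    also have "\<dots> = col E k"
      using col_mult2[OF E E k(1)] idem by simp
    finally show "col (E * B) j = col B j" using k by simp
  qed (use E B in auto)
  then have BCB: "B * (C * B) = B"
    using BC B C by simp
  have "C * B = 1\<^sub>m (rank E)"
  proof (rule mat_col_eqI)
    fix j assume "j < dim_col (1\<^sub>m (rank E))"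
    then have j: "j < rank E" by simp
    have CB: "C * B \<in> carrier_mat (rank E) (rank E)" using B C by simp
    have "B *\<^sub>v col (C * B) j = col B j"
      using col_mult2[OF B CB j] BCB by simp
    moreover have "B *\<^sub>v col (1\<^sub>m (rank E)) j = col B j"
      using col_mult2[OF B one_carrier_mat j] B by simp
    \<comment> \<open>Cancellation is done column by column: the difference of the j-th columns of
      \<open>C * B\<close> and the identity lies in the kernel of \<open>B\<close>.\<close>
    ultimately have "B *\<^sub>v (col (C * B) j - col (1\<^sub>m (rank E)) j) = 0\<^sub>v n"
      using B CB j by (subst mult_minus_distrib_mat_vec[OF B]) auto
    moreover have dims: "col (C * B) j \<in> carrier_vec (rank E)"
      "col (1\<^sub>m (rank E)) j \<in> carrier_vec (rank E)"
      using C j by (auto intro!: carrier_vecI)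
    ultimately have "col (C * B) j - col (1\<^sub>m (rank E)) j = 0\<^sub>v (rank E)"
      using inj minus_carrier_vec by blast
    then have "(col (C * B) j - col (1\<^sub>m (rank E)) j) $ i = 0" if "i < rank E" for i
      using that by simp
    then show "col (C * B) j = col (1\<^sub>m (rank E)) j"
      using dims C by (intro eq_vecI) auto
  qed (use B C in auto)
  then show ?thesis using that[OF B C BC[symmetric]] by simp
qed

section \<open>Simultaneous splitting of orthogonal idempotents\<close>

lemma inverse_mats_square:
  fixes P Q :: "'a :: field_char_0 mat"
  assumes P: "P \<in> carrier_mat n s" and Q: "Q \<in> carrier_mat s n"
    and PQ: "P * Q = 1\<^sub>m n" and QP: "Q * P = 1\<^sub>m s"
  shows "s = n"
proof -
  \<comment> \<open>\<open>P Q\<close> and \<open>Q P\<close> have the same trace.\<close>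
  have "of_nat n = (\<Sum>i<n. (P * Q) $$ (i, i))"
    by (simp add: PQ)
  also have "\<dots> = (\<Sum>i<n. \<Sum>k<s. P $$ (i, k) * Q $$ (k, i))"
    using P Q by (simp add: scalar_prod_def lessThan_atLeast0)
  also have "\<dots> = (\<Sum>k<s. \<Sum>i<n. Q $$ (k, i) * P $$ (i, k))"
    by (subst sum.swap) (simp add: mult.commute)
  also have "\<dots> = (\<Sum>k<s. (Q * P) $$ (k, k))"
    using P Q by (simp add: scalar_prod_def lessThan_atLeast0)
  also have "\<dots> = of_nat s"
    by (simp add: QP)
  finally show ?thesis
    by (simp only: of_nat_eq_iff)
qed

text \<open>Because of the blocks of size 0, the factors are the row [A | B] and the stack of A'
  over B'. This computes \<open>P * Q\<close> when a new idempotent is added in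
  \<open>simultaneous_splitting\<close>.\<close>

lemma four_block_mat_empty_rows:
  assumes "A \<in> carrier_mat n r" "B \<in> carrier_mat n s" "A' \<in> carrier_mat r n" "B' \<in> carrier_mat s n"
  shows "four_block_mat A B (0\<^sub>m 0 r) (0\<^sub>m 0 s) * four_block_mat A' (0\<^sub>m r 0) B' (0\<^sub>m s 0)
    = A * A' + B * B'"
  using assms
  by (subst mult_four_block_mat[where ?nr1.0 = n and ?n1.0 = r and ?n2.0 = s and ?nr2.0 = 0
        and ?nc1.0 = n and ?nc2.0 = 0]) (auto intro!: eq_matI)

lemma mult_sum_mat_zero:
  fixes E :: "'a :: comm_ring_1 mat"
  assumes "E \<in> carrier_mat n n" "set Es \<subseteq> carrier_mat n n"
    and "\<And>F. F \<in> set Es \<Longrightarrow> E * F = 0\<^sub>m n n"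
  shows "E * foldr (+) Es (0\<^sub>m n n) = 0\<^sub>m n n"
    and "foldr (+) Es (0\<^sub>m n n) \<in> carrier_mat n n"
proof -
  \<comment> \<open>Distributivity needs the dimensions of the partial sums, so carrier membership
    is proved in the same induction.\<close>
  have "foldr (+) Es (0\<^sub>m n n) \<in> carrier_mat n n \<and> E * foldr (+) Es (0\<^sub>m n n) = 0\<^sub>m n n"
    using assms(2,3)
    by (induction Es) (use assms(1) in \<open>auto simp: mult_add_distrib_mat[of E n n _ n]\<close>)
  then show "E * foldr (+) Es (0\<^sub>m n n) = 0\<^sub>m n n"
    and "foldr (+) Es (0\<^sub>m n n) \<in> carrier_mat n n" by auto
qed

lemma sum_mult_mat_zero:
  fixes E :: "'a :: comm_ring_1 mat"
  assumes "E \<in> carrier_mat n n" "set Es \<subseteq> carrier_mat n n"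
    and "\<And>F. F \<in> set Es \<Longrightarrow> F * E = 0\<^sub>m n n"
  shows "foldr (+) Es (0\<^sub>m n n) * E = 0\<^sub>m n n"
proof -
  have "foldr (+) Es (0\<^sub>m n n) \<in> carrier_mat n n \<and> foldr (+) Es (0\<^sub>m n n) * E = 0\<^sub>m n n"
    using assms(2,3)
    by (induction Es) (use assms(1) in \<open>auto simp: add_mult_distrib_mat[of _ n n _ E n]\<close>)
  then show ?thesis by auto
qed

text \<open>Since \<open>X\<close> absorbs \<open>F\<close> and \<open>Y\<close> absorbs
  \<open>F'\<close>, both may be inserted around \<open>A\<close>. This is how off-diagonal blocks
  are shown to vanish.\<close>

lemma mat_mult_zero_middle:
  fixes X :: "'a :: comm_ring_1 mat"
  assumes X: "X \<in> carrier_mat a n" and F: "F \<in> carrier_mat n n" and A: "A \<in> carrier_mat n n"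
    and F': "F' \<in> carrier_mat n n" and Y: "Y \<in> carrier_mat n b"
    and "X * F = X" "F' * Y = Y" "F * A * F' = 0\<^sub>m n n"
  shows "X * A * Y = 0\<^sub>m a b"
proof -
  have "X * A * Y = (X * F) * A * (F' * Y)"
    by (simp only: assms)
  also have "\<dots> = X * (F * A * F') * Y"
    using X F A F' Y by (simp add: assoc_mult_mat[of _ a n _ n _ b] assoc_mult_mat[of _ n n _ n _ b])
  also have "\<dots> = 0\<^sub>m a b"
    using assms by simp
  finally show ?thesis .
qed

text \<open>Completeness would be lost when an idempotent is removed, so the induction works with
  any orthogonal list: \<open>P\<close> may be rectangular and \<open>P * Q\<close> is only the sum
  of the idempotents. The step splits the new idempotent as \<open>B * C\<close> and puts
  \<open>B\<close> to the left of \<open>P\<close> and \<open>C\<close> on top of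
  \<open>Q\<close>.\<close>

lemma simultaneous_splitting:
  fixes Es :: "'a :: field mat list"
  assumes "set Es \<subseteq> carrier_mat n n" "distinct Es"
    and "\<And>E. E \<in> set Es \<Longrightarrow> E * E = E"
    and "\<And>E F. E \<in> set Es \<Longrightarrow> F \<in> set Es \<Longrightarrow> E \<noteq> F \<Longrightarrow> E * F = 0\<^sub>m n n"
  shows "\<exists>P Q. P \<in> carrier_mat n (sum_list (map (vec_space.rank n) Es)) \<and>
    Q \<in> carrier_mat (sum_list (map (vec_space.rank n) Es)) n \<and>
    P * Q = foldr (+) Es (0\<^sub>m n n) \<and> Q * P = 1\<^sub>m (sum_list (map (vec_space.rank n) Es)) \<and>
    (\<forall>A \<in> carrier_mat n n. (\<forall>E \<in> set Es. E * A = A * E) \<longrightarrow>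
      (\<exists>Ts. list_all2 (\<lambda>T r. T \<in> carrier_mat r r) Ts (map (vec_space.rank n) Es) \<and>
        Q * A * P = diag_block_mat Ts))"
  using assms
proof (induction Es)
  case Nil
  \<comment> \<open>The product of an n x 0 and a 0 x n matrix is the n x n zero matrix, which is
    the empty sum.\<close>
  show ?case
    by (intro exI[of _ "0\<^sub>m n 0"] exI[of _ "0\<^sub>m 0 n"]) (auto intro!: eq_matI exI[of _ "[]"])
next
  case (Cons E Es)
  let ?r = "vec_space.rank n E" and ?s = "sum_list (map (vec_space.rank n) Es)"
  let ?S = "foldr (+) Es (0\<^sub>m n n)"
  have E: "E \<in> carrier_mat n n" and EE: "E * E = E" using Cons.prems by auto
  have "\<exists>P Q. P \<in> carrier_mat n ?s \<and> Q \<in> carrier_mat ?s n \<and> P * Q = ?S \<and> Q * P = 1\<^sub>m ?s \<and>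
    (\<forall>A \<in> carrier_mat n n. (\<forall>E \<in> set Es. E * A = A * E) \<longrightarrow>
      (\<exists>Ts. list_all2 (\<lambda>T r. T \<in> carrier_mat r r) Ts (map (vec_space.rank n) Es) \<and>
        Q * A * P = diag_block_mat Ts))"
    using Cons by simp
  then obtain P Q where P: "P \<in> carrier_mat n ?s" and Q: "Q \<in> carrier_mat ?s n"
    and PQ: "P * Q = ?S" and QP: "Q * P = 1\<^sub>m ?s"
    and IH: "\<And>A. A \<in> carrier_mat n n \<Longrightarrow> \<forall>E \<in> set Es. E * A = A * E \<Longrightarrow>
      \<exists>Ts. list_all2 (\<lambda>T r. T \<in> carrier_mat r r) Ts (map (vec_space.rank n) Es) \<and>
        Q * A * P = diag_block_mat Ts"
    by blast
  obtain B C where B: "B \<in> carrier_mat n ?r" and C: "C \<in> carrier_mat ?r n"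
    and BC: "B * C = E" and CB: "C * B = 1\<^sub>m ?r"
    using vec_space.idempotent_rank_splitting[OF E EE] by metis
  have orth: "E * F = 0\<^sub>m n n" "F * E = 0\<^sub>m n n" if "F \<in> set Es" for F
    using Cons.prems that by auto
  have S: "?S \<in> carrier_mat n n" and ES: "E * ?S = 0\<^sub>m n n" and SE: "?S * E = 0\<^sub>m n n"
    using mult_sum_mat_zero[OF E] sum_mult_mat_zero[OF E] orth Cons.prems(1) by auto
  \<comment> \<open>Each factor absorbs the product it comes from, for instance C E = C B C = C
    because C B = 1.\<close>
  have CE: "C * E = C"
    using assoc_mult_mat[OF C B C, unfolded BC CB] C by simp
  have EB: "E * B = B"
    using assoc_mult_mat[OF B C B, unfolded BC CB] B by simp
  have SP: "?S * P = P"
    using assoc_mult_mat[OF P Q P, unfolded PQ QP] P by simp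
  have QS: "Q * ?S = Q"
    using assoc_mult_mat[OF Q P Q, unfolded PQ QP] Q by simp
  \<comment> \<open>With S the sum of the remaining idempotents, E A S = A E S = 0 and S A E = S E A
    = 0; the factors next to A absorb E and S.\<close>
  have off: "C * A * P = 0\<^sub>m ?r ?s" "Q * A * B = 0\<^sub>m ?s ?r"
    if A: "A \<in> carrier_mat n n" and comm: "E * A = A * E" for A
  proof -
    have "E * A * ?S = A * (E * ?S)"
      unfolding comm using A E S by (rule assoc_mult_mat)
    then show "C * A * P = 0\<^sub>m ?r ?s"
      using A by (intro mat_mult_zero_middle[OF C E A S P CE SP]) (simp add: ES)
    have "?S * A * E = ?S * E * A"
      using assoc_mult_mat[OF S E A] assoc_mult_mat[OF S A E] by (simp only: comm)
    then show "Q * A * B = 0\<^sub>m ?s ?r"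
      using A by (intro mat_mult_zero_middle[OF Q S A E B QS EB]) (simp add: SE)
  qed
  \<comment> \<open>\<open>[B | P]\<close> and its counterpart below are block matrices with a block row, respectively column,
    of size 0.\<close>
  let ?P = "four_block_mat B P (0\<^sub>m 0 ?r) (0\<^sub>m 0 ?s)"
  let ?Q = "four_block_mat C (0\<^sub>m ?r 0) Q (0\<^sub>m ?s 0)"
  have PC: "?P \<in> carrier_mat n (?r + ?s)"
    using four_block_carrier_mat[OF B zero_carrier_mat[of 0 ?s]] by simp
  have QC: "?Q \<in> carrier_mat (?r + ?s) n"
    using four_block_carrier_mat[OF C zero_carrier_mat[of ?s 0]] by simp
  have QAP: "?Q * A * ?P = four_block_mat (C * A * B) (C * A * P) (Q * A * B) (Q * A * P)"
    if A: "A \<in> carrier_mat n n" for A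
  proof -
    \<comment> \<open>Empty outer blocks give \<open>A\<close> a shape to which block multiplication
      with \<open>?Q\<close> applies.\<close>
    have A': "A = four_block_mat A (0\<^sub>m n 0) (0\<^sub>m 0 n) (0\<^sub>m 0 0)"
      using A by (auto intro!: eq_matI)
    have "?Q * A = four_block_mat (C * A) (0\<^sub>m ?r 0) (Q * A) (0\<^sub>m ?s 0)"
      using mult_four_block_mat[OF C zero_carrier_mat Q zero_carrier_mat A zero_carrier_mat
          zero_carrier_mat zero_carrier_mat, of 0 0] A C Q
      by (simp flip: A')
    then show ?thesis
      using A B P C Q mult_four_block_mat[OF _ zero_carrier_mat _ zero_carrier_mat B P zero_carrier_mat
          zero_carrier_mat, of "C * A" ?r "Q * A" ?s 0] by simp
  qed
  have "?P * ?Q = foldr (+) (E # Es) (0\<^sub>m n n)"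
    using four_block_mat_empty_rows[OF B P C Q] BC PQ by simp
  moreover have "?Q * ?P = 1\<^sub>m (?r + ?s)"
  proof -
    \<comment> \<open>Inserting the identity reduces \<open>?Q * ?P\<close> to the block formula for
      A = 1, whose off-diagonal blocks vanish since 1 commutes with E.\<close>
    have "?Q * ?P = ?Q * 1\<^sub>m n * ?P"
      by (simp only: right_mult_one_mat[OF QC])
    also have "\<dots> = four_block_mat (C * B) (0\<^sub>m ?r ?s) (0\<^sub>m ?s ?r) (Q * P)"
      unfolding QAP[OF one_carrier_mat] using off[OF one_carrier_mat] E C Q by simp
    finally show ?thesis by (simp add: CB QP)
  qed
  moreover have "\<exists>Ts. list_all2 (\<lambda>T r. T \<in> carrier_mat r r) Ts (map (vec_space.rank n) (E # Es)) \<and>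
        ?Q * A * ?P = diag_block_mat Ts"
    if A: "A \<in> carrier_mat n n" and comm: "\<forall>F \<in> set (E # Es). F * A = A * F" for A
  proof -
    obtain Ts where Ts: "list_all2 (\<lambda>T r. T \<in> carrier_mat r r) Ts (map (vec_space.rank n) Es)"
      "Q * A * P = diag_block_mat Ts"
      using IH[OF A] comm by auto
    \<comment> \<open>These sizes determine the zero blocks that \<open>diag_block_mat\<close>
      places around a new first block.\<close>
    have "dim_row (diag_block_mat Ts) = ?s" "dim_col (diag_block_mat Ts) = ?s"
      using Ts(2) P Q by (metis carrier_matD(1) index_mult_mat(2), metis carrier_matD(2) index_mult_mat(3))
    then have "?Q * A * ?P = diag_block_mat (C * A * B # Ts)"
      unfolding QAP[OF A] using off[OF A] comm B C Ts(2) by (simp add: Let_def)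
    then show ?thesis
      using Ts(1) B C by (intro exI[of _ "C * A * B # Ts"]) auto
  qed
  ultimately show ?case
    using PC QC by (intro exI[of _ ?P] exI[of _ ?Q]) auto
qed

section \<open>The ring of block diagonal matrices\<close>

lemma diag_block_mat_carrier:
  assumes "list_all2 (\<lambda>T r. T \<in> carrier_mat r r) Ts rs"
  shows "diag_block_mat Ts \<in> carrier_mat (sum_list rs) (sum_list rs)"
  using assms by (induction rule: list_all2_induct) (auto simp: Let_def)

lemma block_diag_one:
  "\<exists>Ts. (1\<^sub>m (sum_list rs) :: 'a :: semiring_1 mat) = diag_block_mat Ts \<and>
    list_all2 (\<lambda>T r. T \<in> carrier_mat r r) Ts rs"
proof (intro exI conjI)
  show "1\<^sub>m (sum_list rs) = diag_block_mat (map 1\<^sub>m rs)"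
    using diag_block_one_mat[of "map 1\<^sub>m rs", symmetric] by (simp add: o_def)
qed (simp add: list_all2_conv_all_nth)

lemma block_diag_mult:
  fixes Ts Us :: "'a :: comm_ring_1 mat list"
  assumes "list_all2 (\<lambda>T r. T \<in> carrier_mat r r) Ts rs" "list_all2 (\<lambda>T r. T \<in> carrier_mat r r) Us rs"
  shows "\<exists>Vs. diag_block_mat Ts * diag_block_mat Us = diag_block_mat Vs \<and>
    list_all2 (\<lambda>T r. T \<in> carrier_mat r r) Vs rs"
  using assms
proof (induction rs arbitrary: Ts Us rule: list.induct)
  case Nil
  then have "Ts = []" "Us = []"
    by simp_all
  then show ?case
    by (intro exI[of _ "[]"]) (auto intro!: eq_matI)
next
  case (Cons r rs)
  obtain T Ts' where T: "Ts = T # Ts'" "T \<in> carrier_mat r r" "list_all2 (\<lambda>T r. T \<in> carrier_mat r r) Ts' rs"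
    using Cons.prems(1) by (auto simp: list_all2_Cons2)
  obtain U Us' where U: "Us = U # Us'" "U \<in> carrier_mat r r" "list_all2 (\<lambda>T r. T \<in> carrier_mat r r) Us' rs"
    using Cons.prems(2) by (auto simp: list_all2_Cons2)
  obtain Vs where Vs: "diag_block_mat Ts' * diag_block_mat Us' = diag_block_mat Vs"
    "list_all2 (\<lambda>T r. T \<in> carrier_mat r r) Vs rs"
    using Cons.IH T U by blast
  let ?s = "sum_list rs"
  note c = diag_block_mat_carrier[OF T(3)] diag_block_mat_carrier[OF U(3)] diag_block_mat_carrier[OF Vs(2)]
  have "diag_block_mat Ts * diag_block_mat Us = diag_block_mat (T * U # Vs)"
    using T(2) U(2) c unfolding T(1) U(1) diag_block_mat.simps Let_def
    by (subst mult_four_block_mat[where ?nr1.0 = r and ?n1.0 = r and ?n2.0 = ?s and ?nr2.0 = ?s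
          and ?nc1.0 = r and ?nc2.0 = ?s]) (auto simp: Vs(1))
  then show ?case
    using T U Vs by (intro exI[of _ "T * U # Vs"]) auto
qed

lemma block_diag_add:
  fixes Ts Us :: "'a :: comm_ring_1 mat list"
  assumes "list_all2 (\<lambda>T r. T \<in> carrier_mat r r) Ts rs" "list_all2 (\<lambda>T r. T \<in> carrier_mat r r) Us rs"
  shows "\<exists>Vs. diag_block_mat Ts + diag_block_mat Us = diag_block_mat Vs \<and>
    list_all2 (\<lambda>T r. T \<in> carrier_mat r r) Vs rs"
  using assms
proof (induction rs arbitrary: Ts Us rule: list.induct)
  case Nil
  then have "Ts = []" "Us = []"
    by simp_all
  then show ?case
    by (intro exI[of _ "[]"]) (auto intro!: eq_matI)
next
  case (Cons r rs)
  obtain T Ts' where T: "Ts = T # Ts'" "T \<in> carrier_mat r r" "list_all2 (\<lambda>T r. T \<in> carrier_mat r r) Ts' rs"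
    using Cons.prems(1) by (auto simp: list_all2_Cons2)
  obtain U Us' where U: "Us = U # Us'" "U \<in> carrier_mat r r" "list_all2 (\<lambda>T r. T \<in> carrier_mat r r) Us' rs"
    using Cons.prems(2) by (auto simp: list_all2_Cons2)
  obtain Vs where Vs: "diag_block_mat Ts' + diag_block_mat Us' = diag_block_mat Vs"
    "list_all2 (\<lambda>T r. T \<in> carrier_mat r r) Vs rs"
    using Cons.IH T U by blast
  let ?s = "sum_list rs"
  note c = diag_block_mat_carrier[OF T(3)] diag_block_mat_carrier[OF U(3)] diag_block_mat_carrier[OF Vs(2)]
  have "diag_block_mat Ts + diag_block_mat Us = diag_block_mat ((T + U) # Vs)"
    using T(2) U(2) c unfolding T(1) U(1) diag_block_mat.simps Let_def
    by (subst add_four_block_mat[where ?nr1.0 = r and ?nr2.0 = ?s and ?nc1.0 = r and ?nc2.0 = ?s])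
      (auto simp: Vs(1))
  then show ?case
    using T U Vs by (intro exI[of _ "(T + U) # Vs"]) auto
qed

lemma uminus_diag_block_mat:
  fixes Ts :: "'a :: ring_1 mat list"
  shows "- diag_block_mat Ts = diag_block_mat (map uminus Ts)"
proof (induction Ts)
  case (Cons T Ts)
  have "dim_row (diag_block_mat (map uminus Ts)) = dim_row (diag_block_mat Ts)"
    "dim_col (diag_block_mat (map uminus Ts)) = dim_col (diag_block_mat Ts)"
    by (simp_all flip: Cons.IH)
  then show ?case
    by (auto simp: Let_def simp flip: Cons.IH intro!: eq_matI)
qed (auto intro!: eq_matI)

text \<open>The ring axioms are inherited from the full matrix ring; only closure of the block shape
  under the operations has to be checked.\<close>

lemma ring_block_diag_ring: "ring (block_diag_ring rs)"
proof -
  let ?M = "ring_mat TYPE(complex) (sum_list rs) ()"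
  let ?H = "{diag_block_mat Ts :: complex mat |Ts. list_all2 (\<lambda>T r. T \<in> carrier_mat r r) Ts rs}"
  interpret M: ring ?M by (rule ring_mat)
  have sub: "?H \<subseteq> carrier ?M"
    using diag_block_mat_carrier by (auto simp: ring_mat_simps)
  \<comment> \<open>The additive inverse of the abstract ring is identified with entrywise negation,
    which preserves blocks.\<close>
  have uminus: "\<ominus>\<^bsub>?M\<^esub> A = - A" if "A \<in> carrier_mat (sum_list rs) (sum_list rs)" for A
    using that by (intro M.minus_equality) (auto simp: ring_mat_simps)
  have "subring ?H ?M"
  proof (rule M.subringI[OF sub])
    show "\<one>\<^bsub>?M\<^esub> \<in> ?H"
      using block_diag_one[of rs] by (auto simp: ring_mat_simps)
    show "\<ominus>\<^bsub>?M\<^esub> h \<in> ?H" if h: "h \<in> ?H" for h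
    proof -
      obtain Ts where Ts: "h = diag_block_mat Ts" "list_all2 (\<lambda>T r. T \<in> carrier_mat r r) Ts rs"
        using h by blast
      have "list_all2 (\<lambda>T r. T \<in> carrier_mat r r) (map uminus Ts) rs"
        using Ts(2) by (auto simp: list_all2_conv_all_nth)
      then show ?thesis
        using uminus[OF diag_block_mat_carrier[OF Ts(2)]] Ts(1) uminus_diag_block_mat[of Ts] by auto
    qed
    show "h1 \<otimes>\<^bsub>?M\<^esub> h2 \<in> ?H" if "h1 \<in> ?H" "h2 \<in> ?H" for h1 h2
      using that block_diag_mult by (fastforce simp: ring_mat_simps)
    show "h1 \<oplus>\<^bsub>?M\<^esub> h2 \<in> ?H" if "h1 \<in> ?H" "h2 \<in> ?H" for h1 h2
      using that block_diag_add by (fastforce simp: ring_mat_simps)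
  qed
  then show ?thesis
    unfolding block_diag_ring_def by (rule M.subring_is_ring)
qed

section \<open>The group ring and its matrices\<close>

text \<open>A convolution coefficient sums over factorizations x y, an entry of a matrix product
  over one intermediate element z. The bijection matches the two index sets; its inverse sends (x,
  y) to a x.\<close>

lemma (in group) bij_betw_factorizations:
  assumes "a \<in> carrier G" "b \<in> carrier G"
  shows "bij_betw (\<lambda>z. (inv a \<otimes> z, inv z \<otimes> b)) (carrier G)
    {(x, y) \<in> carrier G \<times> carrier G. x \<otimes> y = inv a \<otimes> b}"
proof (rule bij_betw_byWitness[where f' = "\<lambda>(x, y). a \<otimes> x"])
  show "\<forall>z\<in>carrier G. (\<lambda>(x, y). a \<otimes> x) (inv a \<otimes> z, inv z \<otimes> b) = z"
    using assms by (simp flip: m_assoc)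
  show "\<forall>p\<in>{(x, y) \<in> carrier G \<times> carrier G. x \<otimes> y = inv a \<otimes> b}.
      (inv a \<otimes> (\<lambda>(x, y). a \<otimes> x) p, inv (\<lambda>(x, y). a \<otimes> x) p \<otimes> b) = p"
  proof clarsimp
    fix x y assume xy: "x \<in> carrier G" "y \<in> carrier G" "x \<otimes> y = inv a \<otimes> b"
    have "inv (a \<otimes> x) \<otimes> b = inv x \<otimes> (x \<otimes> y)"
      using assms xy by (simp add: inv_mult_group m_assoc)
    moreover have "inv x \<otimes> (x \<otimes> y) = y" "inv a \<otimes> (a \<otimes> x) = x"
      using assms xy(1,2) by (simp_all flip: m_assoc)
    ultimately show "inv a \<otimes> (a \<otimes> x) = x \<and> inv (a \<otimes> x) \<otimes> b = y"
      by simp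
  qed
  show "(\<lambda>z. (inv a \<otimes> z, inv z \<otimes> b)) ` carrier G
      \<subseteq> {(x, y) \<in> carrier G \<times> carrier G. x \<otimes> y = inv a \<otimes> b}"
    using assms by (auto simp: m_assoc) (simp flip: m_assoc)
  show "(\<lambda>(x, y). a \<otimes> x) ` {(x, y) \<in> carrier G \<times> carrier G. x \<otimes> y = inv a \<otimes> b} \<subseteq> carrier G"
    using assms by auto
qed

locale listed_group = group +
  fixes gs
  assumes distinct_listing: "distinct gs" and set_listing: "set gs = carrier G"
begin

abbreviation "\<sigma> \<equiv> group_ring_mat G gs"

abbreviation "n \<equiv> length gs"

lemma nth_listing_closed [simp]: "i < n \<Longrightarrow> gs ! i \<in> carrier G"
  using set_listing by (metis nth_mem)

lemma group_ring_mat_carrier [simp]: "\<sigma> w \<in> carrier_mat n n"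
  by (simp add: group_ring_mat_def)

text \<open>Only values of \<open>v\<close> and \<open>w\<close> on the group enter either side, so
  no membership in the group ring is assumed. The product entry is the convolution sum after
  reindexing factorizations by z and z by its position in the listing.\<close>

lemma group_ring_mat_mult: "\<sigma> (v \<otimes>\<^bsub>cgroup_ring G\<^esub> w) = \<sigma> v * \<sigma> w"
proof (rule eq_matI)
  fix i j assume "i < dim_row (\<sigma> v * \<sigma> w)" "j < dim_col (\<sigma> v * \<sigma> w)"
  then have i: "i < n" and j: "j < n"
    by (auto simp: group_ring_mat_def)
  let ?a = "gs ! i" and ?b = "gs ! j"
  have "\<sigma> (v \<otimes>\<^bsub>cgroup_ring G\<^esub> w) $$ (i, j) =
      (\<Sum>(x, y) \<in> {(x, y) \<in> carrier G \<times> carrier G. x \<otimes> y = inv ?a \<otimes> ?b}. v x * w y)"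
    using i j by (simp add: group_ring_mat_def cgroup_ring_def)
  also have "\<dots> = (\<Sum>z \<in> carrier G. v (inv ?a \<otimes> z) * w (inv z \<otimes> ?b))"
    using sum.reindex_bij_betw[OF bij_betw_factorizations[of ?a ?b], of "\<lambda>(x, y). v x * w y"] i j
    by simp
  also have "\<dots> = (\<Sum>k<n. v (inv ?a \<otimes> gs ! k) * w (inv (gs ! k) \<otimes> ?b))"
    using sum.reindex_bij_betw[OF bij_betw_nth[OF distinct_listing refl set_listing[symmetric]],
        of "\<lambda>z. v (inv ?a \<otimes> z) * w (inv z \<otimes> ?b)"] by simp
  also have "\<dots> = (\<sigma> v * \<sigma> w) $$ (i, j)"
    using i j by (simp add: group_ring_mat_def scalar_prod_def lessThan_atLeast0)
  finally show "\<sigma> (v \<otimes>\<^bsub>cgroup_ring G\<^esub> w) $$ (i, j) = (\<sigma> v * \<sigma> w) $$ (i, j)" .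
qed (simp_all add: group_ring_mat_def)

lemma group_ring_mat_add: "\<sigma> (v \<oplus>\<^bsub>cgroup_ring G\<^esub> w) = \<sigma> v + \<sigma> w"
  by (rule eq_matI) (simp_all add: group_ring_mat_def cgroup_ring_def)

lemma group_ring_mat_zero: "\<sigma> \<zero>\<^bsub>cgroup_ring G\<^esub> = 0\<^sub>m n n"
  by (rule eq_matI) (simp_all add: group_ring_mat_def cgroup_ring_def)

lemma group_ring_mat_one: "\<sigma> \<one>\<^bsub>cgroup_ring G\<^esub> = 1\<^sub>m n"
proof (rule eq_matI)
  fix i j assume "i < dim_row (1\<^sub>m n :: complex mat)" "j < dim_col (1\<^sub>m n :: complex mat)"
  then have ij: "i < n" "j < n" by simp_all
  have "inv (gs ! i) \<otimes> gs ! j = \<one> \<longleftrightarrow> gs ! i = gs ! j"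
    using ij by (metis inv_solve_left l_inv nth_listing_closed one_closed r_one)
  then show "\<sigma> \<one>\<^bsub>cgroup_ring G\<^esub> $$ (i, j) = 1\<^sub>m n $$ (i, j)"
    using ij distinct_listing by (simp add: group_ring_mat_def cgroup_ring_def nth_eq_iff_index_eq)
qed (simp_all add: group_ring_mat_def)

text \<open>The row belonging to the identity element lists all coefficients: its entry in column j
  is the coefficient of \<open>gs ! j\<close>.\<close>

lemma inj_on_group_ring_mat: "inj_on \<sigma> (carrier (cgroup_ring G))"
proof (rule inj_onI)
  fix v w assume v: "v \<in> carrier (cgroup_ring G)" and w: "w \<in> carrier (cgroup_ring G)"
    and eq: "\<sigma> v = \<sigma> w"
  obtain i where i: "i < n" "gs ! i = \<one>"
    using set_listing one_closed by (metis in_set_conv_nth)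
  have "v g = w g" if "g \<in> carrier G" for g
  proof -
    obtain j where j: "j < n" "gs ! j = g"
      using \<open>g \<in> carrier G\<close> set_listing by (metis in_set_conv_nth)
    then show ?thesis
      using arg_cong[OF eq, of "\<lambda>A. A $$ (i, j)"] i \<open>g \<in> carrier G\<close> by (simp add: group_ring_mat_def)
  qed
  then show "v = w"
    using v w unfolding cgroup_ring_def by (intro ext) (simp, metis)
qed

lemma ring_cgroup_ring: "ring (cgroup_ring G)"
proof (rule ringI)
  show "abelian_group (cgroup_ring G)"
  proof (rule abelian_groupI)
    show "\<exists>y\<in>carrier (cgroup_ring G). y \<oplus>\<^bsub>cgroup_ring G\<^esub> x = \<zero>\<^bsub>cgroup_ring G\<^esub>"
      if "x \<in> carrier (cgroup_ring G)" for x
      using that by (intro bexI[of _ "\<lambda>g. - x g"]) (auto simp: cgroup_ring_def)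
  qed (auto simp: cgroup_ring_def add.assoc add.commute)
  have mult_closed: "v \<otimes>\<^bsub>cgroup_ring G\<^esub> w \<in> carrier (cgroup_ring G)" for v w
  proof -
    \<comment> \<open>An element outside the group has no factorization, so its coefficient is an
      empty sum.\<close>
    have "{(x, y) \<in> carrier G \<times> carrier G. x \<otimes> y = g} = {}" if "g \<notin> carrier G" for g
      using that by auto
    then show ?thesis by (simp add: cgroup_ring_def del: Collect_empty_eq)
  qed
  have add_closed: "v \<oplus>\<^bsub>cgroup_ring G\<^esub> w \<in> carrier (cgroup_ring G)"
    if "v \<in> carrier (cgroup_ring G)" "w \<in> carrier (cgroup_ring G)" for v w
    using that by (simp add: cgroup_ring_def)
  have one_closed: "\<one>\<^bsub>cgroup_ring G\<^esub> \<in> carrier (cgroup_ring G)"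
    by (auto simp: cgroup_ring_def)
  \<comment> \<open>The laws of multiplication are pulled back from matrices along the injective \<open>\<sigma>\<close>.\<close>
  show "monoid (cgroup_ring G)"
    by (rule monoidI) (auto simp: group_ring_mat_mult group_ring_mat_one mult_closed one_closed
        intro!: inj_onD[OF inj_on_group_ring_mat] assoc_mult_mat[of _ n n _ n _ n]
        left_mult_one_mat[of _ n n] right_mult_one_mat[of _ n n])
  show "(x \<oplus>\<^bsub>cgroup_ring G\<^esub> y) \<otimes>\<^bsub>cgroup_ring G\<^esub> z =
      x \<otimes>\<^bsub>cgroup_ring G\<^esub> z \<oplus>\<^bsub>cgroup_ring G\<^esub> y \<otimes>\<^bsub>cgroup_ring G\<^esub> z" for x y z
    by (auto simp: group_ring_mat_mult group_ring_mat_add mult_closed add_closed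
        intro!: inj_onD[OF inj_on_group_ring_mat] add_mult_distrib_mat[of _ n n _ _ n])
  show "z \<otimes>\<^bsub>cgroup_ring G\<^esub> (x \<oplus>\<^bsub>cgroup_ring G\<^esub> y) =
      z \<otimes>\<^bsub>cgroup_ring G\<^esub> x \<oplus>\<^bsub>cgroup_ring G\<^esub> z \<otimes>\<^bsub>cgroup_ring G\<^esub> y" for x y z
    by (auto simp: group_ring_mat_mult group_ring_mat_add mult_closed add_closed
        intro!: inj_onD[OF inj_on_group_ring_mat] mult_add_distrib_mat[of _ n n _ n])
qed

text \<open>This carries the completeness condition, a sum over a set, to the list sum of matrices
  in \<open>simultaneous_splitting\<close>. Distinctness keeps repeated entries from being counted
  twice in the list sum.\<close>

lemma group_ring_mat_finsum:
  assumes "set es \<subseteq> carrier (cgroup_ring G)" "distinct es"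
  shows "\<sigma> (\<Oplus>\<^bsub>cgroup_ring G\<^esub> e \<in> set es. e) = foldr (+) (map \<sigma> es) (0\<^sub>m n n)"
  using assms
proof (induction es)
  case Nil
  interpret R: ring "cgroup_ring G" by (rule ring_cgroup_ring)
  show ?case by (simp add: group_ring_mat_zero)
next
  case (Cons e es)
  interpret R: ring "cgroup_ring G" by (rule ring_cgroup_ring)
  have "(\<Oplus>\<^bsub>cgroup_ring G\<^esub> f \<in> set (e # es). f) = e \<oplus>\<^bsub>cgroup_ring G\<^esub> (\<Oplus>\<^bsub>cgroup_ring G\<^esub> f \<in> set es. f)"
    using Cons.prems by (simp only: list.set, intro R.finsum_insert) auto
  then show ?case
    using Cons by (simp add: group_ring_mat_add)
qed

end

section \<open>Conjugation into block diagonal form\<close>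

text \<open>Inverses in a ring are unique, so the abstract inverse in \<open>conj_mat\<close> can be
  replaced by any explicit two-sided inverse.\<close>

lemma conj_mat_eq:
  assumes "P \<in> carrier_mat n n" "Q \<in> carrier_mat n n" "P * Q = 1\<^sub>m n" "Q * P = 1\<^sub>m n"
  shows "conj_mat n P A = Q * A * P"
proof -
  interpret M: ring "ring_mat TYPE(complex) n ()" by (rule ring_mat)
  have "Q = inv\<^bsub>ring_mat TYPE(complex) n ()\<^esub> P"
    using assms by (intro M.inv_unique') (simp_all add: ring_mat_simps)
  then show ?thesis by (simp add: conj_mat_def)
qed

context listed_group
begin

text \<open>The images of the idempotents under \<sigma> satisfy the hypotheses of
  \<open>simultaneous_splitting\<close>, and centrality makes them commute with every
  \<open>\<sigma> w\<close>. The equation for \<open>sum_list rs\<close> ensures that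
  \<open>block_diag_ring rs\<close> consists of matrices of the size of the listing.\<close>

lemma exists_block_diagonalizes:
  assumes es: "distinct es" "\<And>e. e \<in> set es \<Longrightarrow> central_idempotent (cgroup_ring G) e"
    and complete: "complete_orthogonal_idempotents (cgroup_ring G) (set es)"
    and rs: "rs = map (\<lambda>e. vec_space.rank n (\<sigma> e)) es"
  shows "sum_list rs = n" and "\<exists>P. block_diagonalizes G gs rs P"
proof -
  let ?Es = "map \<sigma> es"
  have carr: "set es \<subseteq> carrier (cgroup_ring G)"
    using complete by (simp add: complete_orthogonal_idempotents_def)
  have "distinct ?Es"
    using es(1) inj_on_subset[OF inj_on_group_ring_mat carr] by (simp add: distinct_map)
  moreover have "set ?Es \<subseteq> carrier_mat n n"
    by auto
  moreover have "E * E = E" if "E \<in> set ?Es" for E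
    using that complete
    by (auto simp: complete_orthogonal_idempotents_def simp flip: group_ring_mat_mult)
  moreover have "E * F = 0\<^sub>m n n" if "E \<in> set ?Es" "F \<in> set ?Es" "E \<noteq> F" for E F
  proof -
    obtain e f where ef: "e \<in> set es" "f \<in> set es" "E = \<sigma> e" "F = \<sigma> f"
      using \<open>E \<in> set ?Es\<close> \<open>F \<in> set ?Es\<close> by auto
    then have "e \<otimes>\<^bsub>cgroup_ring G\<^esub> f = \<zero>\<^bsub>cgroup_ring G\<^esub>"
      using complete \<open>E \<noteq> F\<close> by (auto simp: complete_orthogonal_idempotents_def)
    then show ?thesis
      using ef by (simp flip: group_ring_mat_mult group_ring_mat_zero)
  qed
  ultimately have "\<exists>P Q. P \<in> carrier_mat n (sum_list (map (vec_space.rank n) ?Es)) \<and>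
      Q \<in> carrier_mat (sum_list (map (vec_space.rank n) ?Es)) n \<and>
      P * Q = foldr (+) ?Es (0\<^sub>m n n) \<and> Q * P = 1\<^sub>m (sum_list (map (vec_space.rank n) ?Es)) \<and>
      (\<forall>A \<in> carrier_mat n n. (\<forall>E \<in> set ?Es. E * A = A * E) \<longrightarrow>
        (\<exists>Ts. list_all2 (\<lambda>T r. T \<in> carrier_mat r r) Ts (map (vec_space.rank n) ?Es) \<and>
          Q * A * P = diag_block_mat Ts))"
    by (intro simultaneous_splitting)
  moreover have rs': "map (vec_space.rank n) ?Es = rs"
    by (simp add: rs o_def)
  moreover have sum: "foldr (+) ?Es (0\<^sub>m n n) = 1\<^sub>m n"
    using complete group_ring_mat_finsum[OF carr es(1)]
    by (simp add: complete_orthogonal_idempotents_def group_ring_mat_one)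
  ultimately obtain P Q where P: "P \<in> carrier_mat n (sum_list rs)"
    and Q: "Q \<in> carrier_mat (sum_list rs) n"
    and PQ: "P * Q = 1\<^sub>m n" and QP: "Q * P = 1\<^sub>m (sum_list rs)"
    and diag: "\<And>A. A \<in> carrier_mat n n \<Longrightarrow> \<forall>E \<in> set ?Es. E * A = A * E \<Longrightarrow>
      \<exists>Ts. list_all2 (\<lambda>T r. T \<in> carrier_mat r r) Ts rs \<and> Q * A * P = diag_block_mat Ts"
    by (simp only: rs' sum) blast
  \<comment> \<open>By completeness \<open>P * Q\<close> is the identity as well, which forces the a
    priori rectangular \<open>P\<close> to be square.\<close>
  show n: "sum_list rs = n"
    using inverse_mats_square[OF P Q PQ QP] .
  note PQ' = P[unfolded n] Q[unfolded n] PQ QP[unfolded n]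
  have "invertible_mat P"
    using PQ' unfolding invertible_mat_def inverts_mat_def by auto
  moreover have "conj_mat n P (\<sigma> w) \<in> carrier (block_diag_ring rs)"
    if w: "w \<in> carrier (cgroup_ring G)" for w
  proof -
    have "e \<otimes>\<^bsub>cgroup_ring G\<^esub> w = w \<otimes>\<^bsub>cgroup_ring G\<^esub> e" if "e \<in> set es" for e
      using es(2)[OF that] w by (simp add: central_idempotent_def)
    then have "\<forall>E \<in> set ?Es. E * \<sigma> w = \<sigma> w * E"
      by (simp flip: group_ring_mat_mult)
    from diag[OF group_ring_mat_carrier this] show ?thesis
      by (auto simp: conj_mat_eq[OF PQ'] block_diag_ring_def)
  qed
  ultimately show "\<exists>P. block_diagonalizes G gs rs P"
    using PQ'(1) by (auto simp: block_diagonalizes_def)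
qed

text \<open>Conjugation respects products because P Q = 1 cancels between the factors, and it is
  injective because it can be undone and \<sigma> is injective.\<close>

lemma conj_mat_ring_iso:
  assumes rs: "sum_list rs = n" and P: "block_diagonalizes G gs rs P"
  defines "\<phi> \<equiv> \<lambda>w. conj_mat n P (\<sigma> w)"
  shows "subring (\<phi> ` carrier (cgroup_ring G)) (block_diag_ring rs)"
    and "\<phi> \<in> ring_iso (cgroup_ring G)
      ((block_diag_ring rs)\<lparr>carrier := \<phi> ` carrier (cgroup_ring G)\<rparr>)"
proof -
  let ?R = "cgroup_ring G" and ?B = "block_diag_ring rs"
  have Pn: "P \<in> carrier_mat n n" and inv: "invertible_mat P"
    and closed: "\<And>w. w \<in> carrier ?R \<Longrightarrow> \<phi> w \<in> carrier ?B"
    using P by (auto simp: block_diagonalizes_def \<phi>_def)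
  obtain Q where PQ: "P * Q = 1\<^sub>m n" and QP: "Q * P = 1\<^sub>m (dim_row Q)"
    using inv Pn unfolding invertible_mat_def inverts_mat_def by auto
  \<comment> \<open>The inverse comes without dimensions: P Q = 1 fixes its number of columns, and Q
    P = 1 its number of rows.\<close>
  have Q: "Q \<in> carrier_mat n n"
    using arg_cong[OF PQ, of dim_col] arg_cong[OF QP, of dim_col] Pn by auto
  then have QP: "Q * P = 1\<^sub>m n"
    using QP by simp
  have \<phi>: "\<phi> w = Q * \<sigma> w * P" for w
    unfolding \<phi>_def by (rule conj_mat_eq[OF Pn Q PQ QP])
  have ops: "mult ?B = (*)" "add ?B = (+)" "one ?B = 1\<^sub>m n"
    by (simp_all add: block_diag_ring_def ring_mat_simps rs)
  have mult: "\<phi> (v \<otimes>\<^bsub>?R\<^esub> w) = \<phi> v * \<phi> w" for v w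
  proof -
    have "\<phi> v * \<phi> w = Q * \<sigma> v * (P * Q) * \<sigma> w * P"
      unfolding \<phi> using Q Pn group_ring_mat_carrier[of v] group_ring_mat_carrier[of w]
      by (simp add: assoc_mult_mat[of _ n n _ n _ n] mult_carrier_mat[of _ n n _ n])
    also have "\<dots> = \<phi> (v \<otimes>\<^bsub>?R\<^esub> w)"
      unfolding \<phi> PQ group_ring_mat_mult
      using Q Pn group_ring_mat_carrier[of v] group_ring_mat_carrier[of w]
      by (simp add: assoc_mult_mat[of _ n n _ n _ n] mult_carrier_mat[of _ n n _ n]
          left_mult_one_mat[of _ n n])
    finally show ?thesis ..
  qed
  have add: "\<phi> (v \<oplus>\<^bsub>?R\<^esub> w) = \<phi> v + \<phi> w" for v w
    unfolding \<phi> group_ring_mat_add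
    using Q Pn group_ring_mat_carrier[of v] group_ring_mat_carrier[of w]
    by (simp add: mult_add_distrib_mat[of _ n n _ n] add_mult_distrib_mat[of _ n n _ _ n])
  have one: "\<phi> \<one>\<^bsub>?R\<^esub> = 1\<^sub>m n"
    unfolding \<phi> group_ring_mat_one using Q QP by simp
  have hom: "\<phi> \<in> Ring.ring_hom ?R ?B"
    by (rule ring_hom_memI) (simp_all add: closed mult add one ops)
  then interpret ring_hom_ring ?R ?B \<phi>
    by (intro ring_hom_ringI2 ring_cgroup_ring ring_block_diag_ring)
  show "subring (\<phi> ` carrier ?R) ?B"
    by (rule img_is_subring) (rule R.carrier_is_subring)
  \<comment> \<open>Conjugating back recovers \<open>\<sigma> w\<close> from
    \<open>\<phi> w\<close>.\<close>
  have "\<sigma> w = P * \<phi> w * Q" for w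
  proof -
    have "P * \<phi> w * Q = (P * Q) * \<sigma> w * (P * Q)"
      unfolding \<phi> using Q Pn group_ring_mat_carrier[of w]
      by (simp add: assoc_mult_mat[of _ n n _ n _ n] mult_carrier_mat[of _ n n _ n])
    then show ?thesis
      using group_ring_mat_carrier[of w] by (simp add: PQ)
  qed
  then have "inj_on \<phi> (carrier ?R)"
    by (intro inj_onI inj_onD[OF inj_on_group_ring_mat]) simp_all
  \<comment> \<open>The target carrier is the image itself, so bijectivity amounts to
    injectivity.\<close>
  then show "\<phi> \<in> ring_iso ?R (?B\<lparr>carrier := \<phi> ` carrier ?R\<rparr>)"
    by (intro ring_iso_memI) (simp_all add: mult add one ops inj_on_imp_bij_betw)
qed

end

theorem corollary3p2:
  fixes G :: "('g, 'm) monoid_scheme"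
    and n :: nat
    and gs :: "'g list"
    and es :: "('g \<Rightarrow> complex) list"
    and rs :: "nat list"
  assumes "group G" and "finite (carrier G)" and "Coset.order G = n"
    and "distinct gs" and "set gs = carrier G"
    and "distinct es" and "set es = {e. primitive_central_idempotent (cgroup_ring G) e}"
    and "complete_orthogonal_idempotents (cgroup_ring G) (set es)"
    and "rs = map (\<lambda>e. vec_space.rank n (group_ring_mat G gs e)) es"
  shows "ring (cgroup_ring G) \<and> ring (block_diag_ring rs) \<and>
    (\<exists>P. block_diagonalizes G gs rs P) \<and>
    (\<forall>P. block_diagonalizes G gs rs P \<longrightarrow>
       (let \<phi> = (\<lambda>w. conj_mat n P (group_ring_mat G gs w));
            S = \<phi> ` carrier (cgroup_ring G)
        in subring S (block_diag_ring rs) \<and>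
           \<phi> \<in> ring_iso (cgroup_ring G) ((block_diag_ring rs)\<lparr>carrier := S\<rparr>)))"
proof -
  interpret listed_group G gs
    using assms by (simp add: listed_group_def listed_group_axioms_def)
  have n: "n = length gs"
    using assms(3-5) distinct_card[of gs] by (simp add: Coset.order_def)
  have "central_idempotent (cgroup_ring G) e" if "e \<in> set es" for e
    using that assms by (simp add: primitive_central_idempotent_def)
  \<comment> \<open>The size equation in the first part of \<open>ex\<close> is also what
    \<open>conj_mat_ring_iso\<close> requires for an arbitrary \<open>P\<close>.\<close>
  note ex = exists_block_diagonalizes[OF \<open>distinct es\<close> this assms(8) assms(9)[unfolded n]]
  show ?thesis
    unfolding Let_def n
    using ring_cgroup_ring ring_block_diag_ring ex conj_mat_ring_iso[OF ex(1)] by simp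
qed

end
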